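(* For each $N$ let $(X_n)_{0\le n\le N}$ be the edge-counting process of the growing random graph with $N$ vertices, and let $\varphi(t)=2(1-t)\log(1-t)+2t-t^2$ for $t\in[0,1)$, $\varphi(1)=1$. Then, as $N\to\infty$, $$\sup_{t\in[0,1]}\left|\frac{2}{N^2}\,X_{\lfloor tN\rfloor}-\varphi(t)\right|\stackrel{\mathbb P}{\to}0,$$ where $\stackrel{\mathbb P}{\to}$ denotes convergence in probability.
   Context: Growing random graph. Fix $N$. Initially there is a pool of $N$ virtual vertices and no edges. At each step, an element is selected uniformly at random from the current pool of virtual elements (vertices and edges), removed from the pool, and declared occupied. When the $n$-th vertex becomes occupied (it is then labelled $n$), the $n-1$ edges linking it to the previously occupied vertices $1,\dots,n-1$ are added to the pool as virtual edges. Thus when there are $n$ occupied vertices and $k$ occupied edges, the pool consists of $N-n$ virtual vertices and $\binom n2-k$ virtual edges. The process continues until the pool is empty (complete graph on $N$ vertices). For $1\le n\le N$, $X_n$ is the number of occupied edges at the moment the $n$-th vertex becomes occupied; $X_0=0$. The law of $(X_n)$ depends on $N$. Equivalently, $(X_n)$ is a Markov chain with $X_0=X_1=0$ such that, for $1\le n<N$, given $X_n=k$, the increment $X_{n+1}-X_n$ is the number of black balls drawn before the first white ball when sampling uniformly without replacement from an urn with $\binom n2-k$ black and $N-n$ white balls. The function $\varphi$ is also given by $\varphi(t)=2\int_0^t\frac{s(t-s)}{1-s}\,\mathrm ds$. *)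

theory Defs
  imports "HOL-Probability.Probability"
begin

text \<open>
  The \<open>N\<close> vertices are represented by the numbers below \<open>N\<close>, an edge by the set of its two
  endpoints. A history is the list of occupied elements in order of occupation; the \<open>n\<close>-th vertex
  in this list is the vertex labelled \<open>n\<close>.
\<close>

datatype element = Vertex nat | Edge "nat set"

definition occupied_vertices :: "element list \<Rightarrow> nat set" where
  "occupied_vertices h = {v. Vertex v \<in> set h}"

definition occupied_edges :: "element list \<Rightarrow> nat set set" where
  "occupied_edges h = {e. Edge e \<in> set h}"

definition pool :: "nat \<Rightarrow> element list \<Rightarrow> element set" where
  "pool N h =
     Vertex ` ({..<N} - occupied_vertices h) \<union>
     Edge ` ({{u, v} | u v. u \<in> occupied_vertices h \<and> v \<in> occupied_vertices h \<and> u \<noteq> v}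
       - occupied_edges h)"

lemma finite_occupied_vertices: "finite (occupied_vertices h)"
  unfolding occupied_vertices_def
  by (rule finite_subset[OF _ finite_vimageI[of "set h" Vertex]]) (auto simp: inj_on_def)

lemma finite_pool: "finite (pool N h)"
proof -
  have "{{u, v} | u v. u \<in> occupied_vertices h \<and> v \<in> occupied_vertices h \<and> u \<noteq> v}
      \<subseteq> Pow (occupied_vertices h)"
    by auto
  then show ?thesis
    unfolding pool_def
    by (metis (no_types, lifting) finite_Diff finite_Pow_iff finite_Un finite_imageI
        finite_lessThan finite_occupied_vertices finite_subset)
qed

text \<open>
  The law of the complete history of the process started from the history \<open>h\<close>, i.e. run until the
  pool is empty. The whole process starts from the empty history.
\<close>

function grow :: "nat \<Rightarrow> element list \<Rightarrow> element list pmf" where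
  "grow N h =
     (if pool N h = {} then return_pmf h
      else bind_pmf (pmf_of_set (pool N h)) (\<lambda>x. grow N (h @ [x])))"
  by pat_completeness auto

termination grow
proof -
  define W where "W = (\<lambda>N h. {..<N} \<union> occupied_vertices h)"
  define U where "U = (\<lambda>N h. Vertex ` W N h \<union> Edge ` Pow (W N h) - set h)"
  show ?thesis
  proof (relation "Wellfounded.measure (\<lambda>(N, h). card (U N h))", goal_cases)
    case 1
    then show ?case by simp
  next
    case (2 N h x)
    then have x: "x \<in> pool N h"
      by (simp add: finite_pool set_pmf_of_set)
    then have W: "W N (h @ [x]) = W N h"
      by (auto simp: W_def pool_def occupied_vertices_def)
    have U: "U N (h @ [x]) = U N h - {x}"
      unfolding U_def W by auto
    have "finite (U N h)"
      by (simp add: U_def W_def finite_occupied_vertices)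
    moreover have "x \<in> U N h"
      using x by (auto simp: U_def W_def pool_def occupied_vertices_def occupied_edges_def)
    ultimately show ?case
      by (simp add: U card_Diff1_less del: card_Diff_insert)
  qed
qed

declare grow.simps [simp del]

definition growing_graph :: "nat \<Rightarrow> element list pmf" where
  "growing_graph N = grow N []"

definition vertex_time :: "element list \<Rightarrow> nat \<Rightarrow> nat" where
  "vertex_time h n = (LEAST m. card (occupied_vertices (take m h)) = n)"

text \<open>
  The edge-counting process, as a random variable on complete histories; it is meaningful for
  \<open>n \<le> N\<close>. Since the time of the \<open>0\<close>-th vertex is \<open>0\<close>, its value at \<open>n = 0\<close> is \<open>0\<close>.
\<close>

definition X :: "nat \<Rightarrow> element list \<Rightarrow> nat" where
  "X n h = card (occupied_edges (take (vertex_time h n) h))"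

definition \<phi> :: "real \<Rightarrow> real" where
  "\<phi> t = (if t = 1 then 1 else 2 * (1 - t) * ln (1 - t) + 2 * t - t\<^sup>2)"

end

theory Submission
  imports Defs "HOL-Real_Asymp.Real_Asymp"
begin

text \<open>
  When \<open>v\<close> vertices and \<open>k\<close> edges are occupied, put \<open>w = N - v\<close> and \<open>y = (v choose 2) - k\<close>, the
  numbers of virtual vertices and edges. Then \<open>y / (w + 1) - (\<Sum>j<v. j / (N - j))\<close> is a martingale
  along the steps of the history; a step increases its second moment by \<open>y / (w * (w + 1)\<^sup>2)\<close>, which is
  of order \<open>1 / N\<close> as long as \<open>v \<le> t * N\<close> with \<open>t < 1\<close>. As there are at most \<open>N\<^sup>2\<close> steps, Chebyshev's
  inequality shows that the martingale is \<open>o(N)\<close> in probability when the vertex \<open>\<lfloor>t * N\<rfloor>\<close> is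
  occupied. The sum is \<open>N * (harm N - harm (N - v)) - v\<close>, and solving for \<open>k\<close> gives the limit \<open>\<phi> t\<close>.
  Monotonicity of \<open>X\<close> in \<open>n\<close> and continuity of \<open>\<phi>\<close> upgrade this to uniform convergence; at \<open>t = 1\<close>,
  where the second moment bound breaks down, \<open>X \<le> N choose 2\<close> suffices.
\<close>

section \<open>Histories\<close>

abbreviation num_vertices :: "element list \<Rightarrow> nat" where
  "num_vertices h \<equiv> card (occupied_vertices h)"

abbreviation num_edges :: "element list \<Rightarrow> nat" where
  "num_edges h \<equiv> card (occupied_edges h)"

definition pairs :: "nat set \<Rightarrow> nat set set" where
  "pairs V = {{u, v} | u v. u \<in> V \<and> v \<in> V \<and> u \<noteq> v}"

lemma pairs_eq: "pairs V = {e. e \<subseteq> V \<and> card e = 2}"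
  by (auto simp: pairs_def card_2_iff)

lemma finite_pairs: "finite V \<Longrightarrow> finite (pairs V)"
  by (simp add: pairs_eq)

lemma card_pairs: "finite V \<Longrightarrow> card (pairs V) = card V choose 2"
  by (simp add: pairs_eq n_subsets)

lemma pairs_mono: "V \<subseteq> W \<Longrightarrow> pairs V \<subseteq> pairs W"
  by (auto simp: pairs_eq)

text \<open>An invariant of the reachable lists, strong enough to make the two parts of the pool
  have exactly \<open>N - v\<close> and \<open>(v choose 2) - k\<close> elements.\<close>

definition history :: "nat \<Rightarrow> element list \<Rightarrow> bool" where
  "history N h \<longleftrightarrow> occupied_vertices h \<subseteq> {..<N} \<and> occupied_edges h \<subseteq> pairs (occupied_vertices h)"

lemma pool_eq:
  "pool N h = Vertex ` ({..<N} - occupied_vertices h) \<union>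
    Edge ` (pairs (occupied_vertices h) - occupied_edges h)"
  by (simp add: pool_def pairs_def)

lemma occupied_vertices_Nil [simp]: "occupied_vertices [] = {}"
  and occupied_vertices_Vertex [simp]:
    "occupied_vertices (h @ [Vertex v]) = insert v (occupied_vertices h)"
  and occupied_vertices_Edge [simp]: "occupied_vertices (h @ [Edge e]) = occupied_vertices h"
  by (auto simp: occupied_vertices_def)

lemma occupied_edges_Nil [simp]: "occupied_edges [] = {}"
  and occupied_edges_Vertex [simp]: "occupied_edges (h @ [Vertex v]) = occupied_edges h"
  and occupied_edges_Edge [simp]: "occupied_edges (h @ [Edge e]) = insert e (occupied_edges h)"
  by (auto simp: occupied_edges_def)

lemma finite_occupied_edges: "finite (occupied_edges h)"
  unfolding occupied_edges_def
  by (rule finite_subset[OF _ finite_vimageI[of "set h" Edge]]) (auto simp: inj_on_def)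

lemma occupied_edges_take_mono:
  "m \<le> m' \<Longrightarrow> occupied_edges (take m h) \<subseteq> occupied_edges (take m' h)"
  using set_take_subset_set_take[of m m' h] by (auto simp: occupied_edges_def)

lemma num_vertices_take_Suc:
  "num_vertices (take (Suc m) h) \<le> Suc (num_vertices (take m h))"
proof (cases "m < length h")
  case True
  then show ?thesis
    by (cases "h ! m")
      (simp_all add: take_Suc_conv_app_nth card_insert_if finite_occupied_vertices)
qed simp

lemma history_Nil: "history N []"
  by (simp add: history_def)

lemma history_step:
  assumes "history N h" "x \<in> pool N h"
  shows "history N (h @ [x])"
  using assms pairs_mono[OF subset_insertI]
  by (fastforce simp: history_def pool_eq)

text \<open>The prefix property freezes \<open>X n\<close> once the \<open>n\<close>-th vertex is
  occupied; the empty pool forces all \<open>N\<close> vertices to be occupied at the end.\<close>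

lemma grow_support:
  assumes "h' \<in> set_pmf (grow N h)" "history N h"
  shows "history N h'" "\<exists>r. h' = h @ r" "pool N h' = {}"
proof -
  have "history N h' \<and> (\<exists>r. h' = h @ r) \<and> pool N h' = {}"
    using assms
  proof (induction N h rule: grow.induct)
    case (1 N h)
    show ?case
    proof (cases "pool N h = {}")
      case True
      with 1 show ?thesis
        by (simp add: grow.simps[of N h])
    next
      case False
      then obtain x where x: "x \<in> pool N h" "h' \<in> set_pmf (grow N (h @ [x]))"
        using 1(2) by (auto simp: grow.simps[of N h] finite_pool)
      with 1(1)[OF False, of x] False history_step[OF 1(3) x(1)] show ?thesis
        by (auto simp: finite_pool)
    qed
  qed
  then show "history N h'" "\<exists>r. h' = h @ r" "pool N h' = {}"
    by auto
qed

lemma num_edges_le: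
  assumes "history N h"
  shows "num_edges h \<le> num_vertices h choose 2"
  using assms card_mono[OF finite_pairs[OF finite_occupied_vertices]]
  by (fastforce simp: history_def card_pairs finite_occupied_vertices)

lemma num_vertices_le:
  assumes "history N h"
  shows "num_vertices h \<le> N"
  using assms card_mono[of "{..<N}"] by (fastforce simp: history_def)

lemma two_choose_two: "2 * real (n choose 2) = real n * (real n - 1)"
proof (induction n)
  case (Suc n)
  have "real (Suc n choose 2) = real n + real (n choose 2)"
    by (simp add: numeral_2_eq_2)
  with Suc show ?case
    by (simp add: algebra_simps)
qed simp

section \<open>Occupation times of vertices and monotonicity of the edge counts\<close>

lemma vertex_time_first:
  assumes "\<And>m. m < length h \<Longrightarrow> num_vertices (take m h) \<noteq> num_vertices h"
  shows "vertex_time (h @ r) (num_vertices h) = length h"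
  unfolding vertex_time_def
proof (rule Least_equality)
  fix m
  assume "num_vertices (take m (h @ r)) = num_vertices h"
  then show "length h \<le> m"
    using assms[of m] by (cases "m < length h") auto
qed simp

text \<open>The hypothesis says that the last entry of \<open>h\<close> brought the vertex count to
  its present value, so the continuation \<open>r\<close> cannot change the least index.\<close>

lemma X_first:
  assumes "\<And>m. m < length h \<Longrightarrow> num_vertices (take m h) \<noteq> num_vertices h"
  shows "X (num_vertices h) (h @ r) = num_edges h"
  by (simp add: X_def vertex_time_first[OF assms])

text \<open>A discrete intermediate value argument: the vertex count starts at 0 and rises by at
  most one per step. It makes the \<open>LEAST\<close> in \<open>vertex_time\<close>
  attained.\<close>

lemma ex_num_vertices_take:
  assumes "n \<le> num_vertices (take M h)"
  shows "\<exists>m\<le>M. num_vertices (take m h) = n"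
  using assms
proof (induction M)
  case (Suc M)
  show ?case
  proof (cases "n \<le> num_vertices (take M h)")
    case True
    then show ?thesis
      using Suc.IH le_SucI by blast
  next
    case False
    then show ?thesis
      using Suc.prems num_vertices_take_Suc[of M h] by (intro exI[of _ "Suc M"]) auto
  qed
qed simp

lemma vertex_time_mono:
  assumes "n \<le> n'" "n' \<le> num_vertices h"
  shows "vertex_time h n \<le> vertex_time h n'"
proof -
  have "\<exists>m. num_vertices (take m h) = n'"
    using ex_num_vertices_take[of n' "length h" h] assms by auto
  then have "num_vertices (take (vertex_time h n') h) = n'"
    unfolding vertex_time_def by (rule LeastI_ex)
  then obtain m where "m \<le> vertex_time h n'" "num_vertices (take m h) = n"
    using ex_num_vertices_take assms(1) by metis
  moreover from this have "vertex_time h n \<le> m"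
    unfolding vertex_time_def by (intro Least_le)
  ultimately show ?thesis
    by simp
qed

lemma X_mono:
  assumes "n \<le> n'" "n' \<le> num_vertices h"
  shows "X n h \<le> X n' h"
  unfolding X_def
  by (intro card_mono finite_occupied_edges occupied_edges_take_mono vertex_time_mono assms)

lemma X_le_num_edges: "X n h \<le> num_edges h"
  unfolding X_def
  by (intro card_mono finite_occupied_edges) (auto simp: occupied_edges_def dest: in_set_takeD)

lemma growing_graph_complete:
  assumes "h \<in> set_pmf (growing_graph N)"
  shows "num_vertices h = N" "history N h"
proof -
  have *: "history N h" "pool N h = {}"
    using assms grow_support[OF _ history_Nil] unfolding growing_graph_def by blast+
  then have "occupied_vertices h = {..<N}"
    by (auto simp: history_def pool_eq)
  with * show "num_vertices h = N" "history N h"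
    by simp_all
qed

section \<open>The martingale and its second moment\<close>

text \<open>The first term is the mean number of edges still to be drawn before the next vertex: an
  urn with \<open>y\<close> black and \<open>w\<close> white balls yields \<open>y / (w + 1)\<close>
  black balls on average before the first white one. The summand \<open>j / (N - j)\<close> offsets
  the \<open>j\<close> virtual edges that vertex \<open>j + 1\<close> brings in.\<close>

definition mart :: "nat \<Rightarrow> nat \<Rightarrow> nat \<Rightarrow> real" where
  "mart N v k = (real (v choose 2) - real k) / (real N - real v + 1) -
    (\<Sum>j<v. real j / (real N - real j))"

lemma mart_0_0: "mart N 0 0 = 0"
  by (simp add: mart_def numeral_2_eq_2)

text \<open>The \<open>v\<close> new virtual edges add \<open>v / w\<close> to the first term, which
  the new summand removes; what remains is \<open>y / w - y / (w + 1)\<close>.\<close>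

lemma mart_vertex:
  fixes N v k :: nat
  assumes "v < N"
  defines "w \<equiv> real N - real v" and "y \<equiv> real (v choose 2) - real k"
  shows "mart N (Suc v) k = mart N v k + y / (w * (w + 1))"
proof -
  have "w > 0"
    using assms by simp
  have c: "real (Suc v choose 2) - real k = y + v"
    by (simp add: y_def numeral_2_eq_2)
  have "(y + v) / w - real v / w = y / (w + 1) + y / (w * (w + 1))"
    using \<open>w > 0\<close> by (simp add: divide_simps) (simp add: algebra_simps)
  then show ?thesis
    unfolding mart_def c by (simp add: y_def w_def)
qed

lemma mart_edge:
  "mart N v (Suc k) = mart N v k - 1 / (real N - real v + 1)"
  by (simp add: mart_def diff_divide_distrib add_divide_distrib)

text \<open>The next element is a vertex with weight \<open>w\<close> and an edge with weight
  \<open>y\<close>. The terms linear in \<open>D\<close> cancel, which is the martingale property;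
  the squared increments give the last term.\<close>

lemma second_moment_step:
  fixes w y D :: real
  assumes "w > 0"
  shows "w * (D + y / (w * (w + 1)))\<^sup>2 + y * (D - 1 / (w + 1))\<^sup>2
    = (w + y) * (D\<^sup>2 + y / (w * (w + 1)\<^sup>2))"
proof -
  \<comment> \<open>In \<open>u\<close> and \<open>z\<close> the claim is a polynomial
    identity.\<close>
  define z where "z = 1 / (w + 1)"
  define u where "u = y / w"
  have y: "y = u * w" and z: "(w + 1) * z = 1"
    using assms by (simp_all add: u_def z_def)
  have "y / (w * (w + 1)) = u * z" "y / (w * (w + 1)\<^sup>2) = u * z\<^sup>2" "1 / (w + 1) = z"
    by (simp_all add: u_def z_def power_divide)
  then show ?thesis
    unfolding y by (simp add: power2_eq_square algebra_simps)
qed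

section \<open>Averaging over the pool\<close>

lemma sum_pool:
  "sum f (pool N h) = (\<Sum>v\<in>{..<N} - occupied_vertices h. f (Vertex v)) +
    (\<Sum>e\<in>pairs (occupied_vertices h) - occupied_edges h. f (Edge e))"
  unfolding pool_eq
  by (subst sum.union_disjoint)
    (auto simp: finite_pairs finite_occupied_vertices sum.reindex inj_on_def)

lemma card_pool_parts:
  assumes "history N h"
  shows "real (card ({..<N} - occupied_vertices h)) = real N - real (num_vertices h)"
    and "real (card (pairs (occupied_vertices h) - occupied_edges h)) =
      real (num_vertices h choose 2) - real (num_edges h)"
  using assms num_edges_le[OF assms] num_vertices_le[OF assms]
  by (simp_all add: history_def card_Diff_subset finite_occupied_vertices finite_occupied_edges
      card_pairs of_nat_diff)

lemma prob_bind_pmf_of_set: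
  assumes "finite S" "S \<noteq> {}"
  shows "measure_pmf.prob (bind_pmf (pmf_of_set S) f) A =
    (\<Sum>x\<in>S. measure_pmf.prob (f x) A) / card S"
proof -
  have "ennreal (measure_pmf.prob (bind_pmf (pmf_of_set S) f) A) =
      (\<Sum>x\<in>S. ennreal (measure_pmf.prob (f x) A)) / card S"
    by (simp add: measure_pmf.emeasure_eq_measure[symmetric] nn_integral_pmf_of_set assms)
  also have "\<dots> = ennreal ((\<Sum>x\<in>S. measure_pmf.prob (f x) A) / card S)"
    using assms
    by (simp add: ennreal_of_nat_eq_real_of_nat divide_ennreal sum_nonneg card_gt_0_iff)
  finally show ?thesis
    by (simp add: sum_nonneg)
qed

text \<open>The second moment of the stopped martingale grows by at most \<open>C\<close> in each step, and the
  coefficient of \<open>C\<close> is the number of steps that remain until the pool is empty.\<close>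

lemma prob_mart_ge:
  fixes C \<delta> :: real
  assumes "history N h" "n \<le> N" "0 < \<delta>"
    and "num_vertices h \<le> n" "\<And>m. m < length h \<Longrightarrow> num_vertices (take m h) < n"
    and C: "C = (real N)\<^sup>2 / (real N - real n + 1) ^ 3"
  shows "measure_pmf.prob (grow N h) {h'. \<delta> \<le> \<bar>mart N n (X n h')\<bar>} \<le>
    ((mart N (num_vertices h) (num_edges h))\<^sup>2 +
      C * (real N + real (N choose 2) - real (num_vertices h) - real (num_edges h))) / \<delta>\<^sup>2"
  using assms
proof (induction N h rule: grow.induct)
  case (1 N h)
  note hist = \<open>history N h\<close>
  define A where "A = {h'. \<delta> \<le> \<bar>mart N n (X n h')\<bar>}"
  define B where "B v k = ((mart N v k)\<^sup>2 +
      C * (real N + real (N choose 2) - real v - real k)) / \<delta>\<^sup>2" for v k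
  define v k where "v = num_vertices h" and "k = num_edges h"
  define w y where "w = real N - real v" and "y = real (v choose 2) - real k"
  have "C \<ge> 0"
    unfolding 1 using \<open>n \<le> N\<close> by simp
  have v: "v \<le> n" "v \<le> N" and k: "k \<le> v choose 2"
    using 1 num_vertices_le[OF hist] num_edges_le[OF hist] by (simp_all add: v_def k_def)
  have "v choose 2 \<le> N choose 2"
    by (rule binomial_right_mono[OF v(2)])
  have "y \<ge> 0"
    using k by (simp add: y_def)
  have "measure_pmf.prob (grow N h) A \<le> B v k"
  proof (cases "v = n")
    case True
    then have X: "X n h' = k" if "h' \<in> set_pmf (grow N h)" for h'
      using that X_first[of h] grow_support(2)[OF that hist] 1(6) unfolding v_def k_def by fastforce
    have rem: "real N + real (N choose 2) - real v - real k \<ge> 0"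
      using v k \<open>v choose 2 \<le> N choose 2\<close> by linarith
    \<comment> \<open>The \<open>n\<close>-th vertex has just been occupied, so \<open>X n\<close>
      is constant on the support and the event is either sure or impossible.\<close>
    show ?thesis
    proof (cases "\<delta> \<le> \<bar>mart N v k\<bar>")
      case True
      then have "\<delta>\<^sup>2 \<le> (mart N v k)\<^sup>2"
        using \<open>0 < \<delta>\<close> by (simp add: abs_le_square_iff[symmetric])
      then have "1 \<le> B v k"
        using rem \<open>C \<ge> 0\<close> \<open>0 < \<delta>\<close> unfolding B_def by (simp add: divide_simps add_increasing2)
      then show ?thesis
        using measure_pmf.prob_le_1 order_trans by blast
    next
      case False
      then have "measure_pmf.prob (grow N h) A = 0"
        using X \<open>v = n\<close> by (auto simp: A_def measure_pmf_zero_iff)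
      moreover have "0 \<le> B v k"
        using rem \<open>C \<ge> 0\<close> by (simp add: B_def)
      ultimately show ?thesis
        by simp
    qed
  next
    case False
    \<comment> \<open>The strict inequality \<open>v < n\<close> provides the \<open>+ 1\<close> in
      \<open>wn\<close>, which keeps the denominator of \<open>C\<close> positive even for
      \<open>n = N\<close>.\<close>
    then have "v < n" "v < N" and "w > 0" and wn: "w \<ge> real N - real n + 1"
      using v \<open>n \<le> N\<close> by (auto simp: w_def)
    have pos: "0 < real N - real n + 1"
      using \<open>n \<le> N\<close> by simp
    have card: "real (card ({..<N} - occupied_vertices h)) = w"
      "real (card (pairs (occupied_vertices h) - occupied_edges h)) = y"
      using card_pool_parts[OF hist] by (simp_all add: v_def k_def w_def y_def)
    have card_pool: "real (card (pool N h)) = w + y"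
      using sum_pool[of "\<lambda>_. 1 :: real" N h] card by simp
    then have ne: "pool N h \<noteq> {}"
      using \<open>w > 0\<close> \<open>y \<ge> 0\<close> by auto
    have step: "measure_pmf.prob (grow N (h @ [x])) A \<le>
        B (num_vertices (h @ [x])) (num_edges (h @ [x]))" if x: "x \<in> pool N h" for x
      unfolding A_def B_def
    proof (rule 1(1)[OF ne])
      show "x \<in> set_pmf (pmf_of_set (pool N h))"
        using x ne by (simp add: finite_pool)
      show "history N (h @ [x])"
        by (rule history_step[OF hist x])
      show "num_vertices (h @ [x]) \<le> n"
        using num_vertices_take_Suc[of "length h" "h @ [x]"] \<open>v < n\<close> by (simp add: v_def)
      \<comment> \<open>The only new proper prefix is \<open>h\<close> itself, which has
        \<open>v < n\<close> vertices.\<close>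
      show "num_vertices (take m (h @ [x])) < n" if "m < length (h @ [x])" for m
        using that 1(6)[of m] \<open>v < n\<close> by (cases "m = length h") (auto simp: v_def)
    qed (use 1 in auto)
    have "real (v choose 2) \<le> real (N choose 2)"
      using \<open>v choose 2 \<le> N choose 2\<close> by simp
    also have "\<dots> \<le> (real N)\<^sup>2"
      using two_choose_two[of N] by (simp add: power2_eq_square algebra_simps)
    finally have "y \<le> (real N)\<^sup>2"
      unfolding y_def by linarith
    moreover have "(real N - real n + 1) ^ 3 \<le> w * (w + 1)\<^sup>2"
    proof -
      have "(real N - real n + 1) ^ 3 \<le> w ^ 3"
        using pos wn by (intro power_mono) auto
      also have "\<dots> = w * w\<^sup>2"
        by (simp add: power3_eq_cube power2_eq_square)
      also have "\<dots> \<le> w * (w + 1)\<^sup>2"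
        using \<open>w > 0\<close> by (intro mult_left_mono power_mono) auto
      finally show ?thesis .
    qed
    ultimately have growth: "y / (w * (w + 1)\<^sup>2) \<le> C"
      unfolding 1 using \<open>y \<ge> 0\<close> pos by (intro frac_le) auto
    define D R where "D = mart N v k" and "R = real N + real (N choose 2) - real v - real k"
    have "(\<Sum>x\<in>pool N h. measure_pmf.prob (grow N (h @ [x])) A) \<le>
        (\<Sum>x\<in>pool N h. B (num_vertices (h @ [x])) (num_edges (h @ [x])))"
      by (intro sum_mono step)
    also have "\<dots> = w * B (Suc v) k + y * B v (Suc k)"
      by (simp add: sum_pool card finite_occupied_vertices finite_occupied_edges flip: v_def k_def)
    \<comment> \<open>Either kind of step uses up one of the \<open>R\<close> remaining elements,
      hence the common factor \<open>R - 1\<close>.\<close>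
    also have "\<dots> = (w * (D + y / (w * (w + 1)))\<^sup>2 + y * (D - 1 / (w + 1))\<^sup>2 +
        (w + y) * (C * (R - 1))) / \<delta>\<^sup>2"
      unfolding B_def mart_vertex[OF \<open>v < N\<close>] mart_edge w_def[symmetric] y_def[symmetric]
        D_def[symmetric] times_divide_eq_right add_divide_distrib[symmetric]
      by (rule arg_cong[where f = "\<lambda>z. z / \<delta>\<^sup>2"]) (simp add: R_def algebra_simps)
    also have "\<dots> = (w + y) * (D\<^sup>2 + y / (w * (w + 1)\<^sup>2) + C * (R - 1)) / \<delta>\<^sup>2"
      unfolding second_moment_step[OF \<open>w > 0\<close>] by (simp add: algebra_simps)
    \<comment> \<open>The increment of the second moment is paid for by the \<open>C\<close> that
      the finished step releases.\<close>
    also have "\<dots> \<le> (w + y) * (D\<^sup>2 + C + C * (R - 1)) / \<delta>\<^sup>2"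
      using growth \<open>w > 0\<close> \<open>y \<ge> 0\<close>
      by (intro divide_right_mono mult_left_mono add_right_mono add_left_mono) auto
    also have "\<dots> = (w + y) * B v k"
      by (simp add: B_def D_def R_def algebra_simps)
    finally show ?thesis
      using \<open>w > 0\<close> \<open>y \<ge> 0\<close> ne card_pool
      by (simp add: grow.simps[of N h] prob_bind_pmf_of_set finite_pool divide_simps mult.commute)
  qed
  then show ?case
    by (simp add: A_def B_def v_def k_def)
qed

section \<open>Convergence at a fixed time\<close>

text \<open>Each summand is \<open>N / (N - j) - 1\<close>, and the reciprocals telescope into
  harmonic numbers.\<close>

lemma sum_div_eq_harm:
  assumes "n \<le> N"
  shows "(\<Sum>j<n. real j / (real N - real j)) = real N * (harm N - harm (N - n)) - real n"
  using assms
proof (induction n)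
  case (Suc n)
  have "N - n = Suc (N - Suc n)"
    using Suc.prems by simp
  then have "harm (N - n) = harm (N - Suc n) + 1 / (real N - real n)"
    using Suc.prems by (metis Suc_leD harm_Suc inverse_eq_divide of_nat_diff)
  with Suc show ?case
    by (simp add: field_simps)
qed simp

lemma tendsto_floor_div:
  assumes "0 \<le> t"
  shows "(\<lambda>N. real (nat \<lfloor>t * real N\<rfloor>) / real N) \<longlonglongrightarrow> t"
proof (rule Lim_transform)
  show "(\<lambda>N. t) \<longlonglongrightarrow> t"
    by simp
  show "(\<lambda>N. real (nat \<lfloor>t * real N\<rfloor>) / real N - t) \<longlonglongrightarrow> 0"
  proof (rule Lim_null_comparison[OF eventually_mono[OF eventually_gt_at_top[of 0]] lim_1_over_n])
    fix N :: nat
    assume "0 < N"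
    have "real (nat \<lfloor>t * real N\<rfloor>) = of_int \<lfloor>t * real N\<rfloor>"
      using assms by simp
    then have "\<bar>t * real N - real (nat \<lfloor>t * real N\<rfloor>)\<bar> \<le> 1"
      by linarith
    then show "norm (real (nat \<lfloor>t * real N\<rfloor>) / real N - t) \<le> 1 / real N"
      using \<open>0 < N\<close> by (simp add: field_simps abs_le_iff)
  qed
qed

lemma nat_floor_le:
  assumes "0 \<le> t"
  shows "real (nat \<lfloor>t * real N\<rfloor>) \<le> t * real N"
  using assms by simp

lemma nat_floor_mult_le:
  assumes "0 \<le> t" "t \<le> 1"
  shows "nat \<lfloor>t * real N\<rfloor> \<le> N"
proof -
  have "t * real N \<le> real N"
    using assms by (intro mult_left_le_one_le) auto
  then show ?thesis
    using nat_floor_le[OF assms(1), of N] by linarith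
qed

text \<open>Since \<open>t < 1\<close>, both indices tend to infinity, so
  \<open>harm m - ln m\<close> tends to the Euler-Mascheroni constant along each. The constants
  cancel and the logarithm of the ratio of the indices remains.\<close>

lemma tendsto_harm_diff:
  assumes "0 \<le> t" "t < 1"
  shows "(\<lambda>N. harm N - harm (N - nat \<lfloor>t * real N\<rfloor>)) \<longlonglongrightarrow> - ln (1 - t)"
proof -
  define n where "n N = nat \<lfloor>t * real N\<rfloor>" for N
  have n: "real (n N) \<le> t * real N" for N
    unfolding n_def by (rule nat_floor_le[OF assms(1)])
  have n_le: "n N \<le> N" for N
    unfolding n_def using assms by (intro nat_floor_mult_le) auto
  have lim: "(\<lambda>N. 1 - real (n N) / real N) \<longlonglongrightarrow> 1 - t"
    unfolding n_def by (intro tendsto_intros tendsto_floor_div assms)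
  have "filterlim (\<lambda>N. (1 - t) * real N) at_top sequentially"
    using assms by (intro filterlim_tendsto_pos_mult_at_top[OF tendsto_const]
        filterlim_real_sequentially) simp
  then have "filterlim (\<lambda>N. real (N - n N)) at_top sequentially"
    by (rule filterlim_at_top_mono) (use n n_le in \<open>simp add: of_nat_diff algebra_simps\<close>)
  then have "filterlim (\<lambda>N. N - n N) at_top sequentially"
    by (simp add: filterlim_sequentially_iff_filterlim_real)
  then have "(\<lambda>N. harm (N - n N) - ln (real (N - n N))) \<longlonglongrightarrow> euler_mascheroni"
    by (rule filterlim_compose[OF euler_mascheroni_LIMSEQ])
  then have "(\<lambda>N. (harm N - ln (real N)) - (harm (N - n N) - ln (real (N - n N))) -
      ln (1 - real (n N) / real N)) \<longlonglongrightarrow> euler_mascheroni - euler_mascheroni - ln (1 - t)"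
    using assms by (intro tendsto_diff tendsto_ln euler_mascheroni_LIMSEQ lim) auto
  moreover have "\<forall>\<^sub>F N in sequentially.
    (harm N - ln (real N)) - (harm (N - n N) - ln (real (N - n N))) - ln (1 - real (n N) / real N) =
      harm N - harm (N - n N)"
    using eventually_gt_at_top[of 0]
  proof eventually_elim
    case (elim N)
    have "t * real N < real N"
      using assms elim by simp
    then have "n N < N"
      using n[of N] by linarith
    then have "1 - real (n N) / real N = real (N - n N) / real N"
      by (simp add: field_simps of_nat_diff)
    then show ?case
      using \<open>n N < N\<close> by (simp add: ln_div)
  qed
  ultimately have "(\<lambda>N. harm N - harm (N - n N)) \<longlonglongrightarrow> euler_mascheroni - euler_mascheroni - ln (1 - t)"
    by (rule Lim_transform_eventually)
  then show ?thesis
    by (simp add: n_def)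
qed

text \<open>At \<open>t = 1\<close> the logarithm is multiplied by 0, so the formula also gives the
  value 1.\<close>

lemma phi_eq: "\<phi> t = 2 * (1 - t) * ln (1 - t) + 2 * t - t\<^sup>2"
  by (simp add: \<phi>_def)

text \<open>The edge count \<open>k\<close> at which \<open>mart N n k\<close> vanishes, that is,
  the deterministic prediction for \<open>X n\<close>.\<close>

definition compensator :: "nat \<Rightarrow> nat \<Rightarrow> real" where
  "compensator N n = real (n choose 2) -
    (real N - real n + 1) * (\<Sum>j<n. real j / (real N - real j))"

lemma edges_eq_compensator:
  assumes "n \<le> N"
  shows "real k = compensator N n - (real N - real n + 1) * mart N n k"
proof -
  have "real N - real n + 1 \<noteq> 0"
    using assms by simp
  then have "(real N - real n + 1) * mart N n k = real (n choose 2) - real k -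
      (real N - real n + 1) * (\<Sum>j<n. real j / (real N - real j))"
    unfolding mart_def by (simp only: right_diff_distrib nonzero_mult_div_cancel_left
        times_divide_eq_right[symmetric]) simp
  then show ?thesis
    by (simp add: compensator_def)
qed

lemma tendsto_compensator:
  assumes "0 \<le> t" "t < 1"
  shows "(\<lambda>N. 2 / (real N)\<^sup>2 * compensator N (nat \<lfloor>t * real N\<rfloor>)) \<longlonglongrightarrow> \<phi> t"
proof -
  define n where "n N = nat \<lfloor>t * real N\<rfloor>" for N
  define a where "a N = real (n N) / real N" for N
  define b where "b N = (harm N - harm (N - n N) :: real)" for N
  have a: "a \<longlonglongrightarrow> t" and b: "b \<longlonglongrightarrow> - ln (1 - t)"
    unfolding a_def n_def b_def
    using tendsto_floor_div[OF assms(1)] tendsto_harm_diff[OF assms] by simp_all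
  have n_le: "n N \<le> N" for N
    unfolding n_def using assms by (intro nat_floor_mult_le) auto
  \<comment> \<open>This is the rescaled compensator in terms of \<open>a\<close> and
    \<open>b\<close>; the terms with \<open>1 / N\<close> come from \<open>n - 1\<close> in the
    binomial coefficient and from the \<open>+ 1\<close> in the denominator of
    \<open>mart\<close>.\<close>
  have "(\<lambda>N. (a N)\<^sup>2 - a N * (1 / real N) - 2 * (1 - a N + 1 / real N) * (b N - a N))
      \<longlonglongrightarrow> t\<^sup>2 - t * 0 - 2 * (1 - t + 0) * (- ln (1 - t) - t)"
    by (intro tendsto_intros a b lim_1_over_n)
  moreover have "t\<^sup>2 - t * 0 - 2 * (1 - t + 0) * (- ln (1 - t) - t) = \<phi> t"
    by (simp add: phi_eq power2_eq_square algebra_simps)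
  moreover have "\<forall>\<^sub>F N in sequentially.
    (a N)\<^sup>2 - a N * (1 / real N) - 2 * (1 - a N + 1 / real N) * (b N - a N) =
      2 / (real N)\<^sup>2 * compensator N (n N)"
    using eventually_gt_at_top[of 0]
  proof eventually_elim
    case (elim N)
    have "real (n N) = a N * real N"
      using elim by (simp add: a_def)
    then have sum: "(\<Sum>j<n N. real j / (real N - real j)) = real N * b N - a N * real N"
      and choose: "2 * real (n N choose 2) = a N * real N * (a N * real N - 1)"
      using sum_div_eq_harm[OF n_le, of N] two_choose_two[of "n N"] by (simp_all add: b_def)
    have "2 * compensator N (n N) = 2 * real (n N choose 2) -
        2 * (real N - real (n N) + 1) * (\<Sum>j<n N. real j / (real N - real j))"
      by (simp add: compensator_def)
    also have "\<dots> = a N * real N * (a N * real N - 1) -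
        2 * (real N - a N * real N + 1) * (real N * b N - a N * real N)"
      unfolding sum choose \<open>real (n N) = a N * real N\<close> ..
    finally have "2 * compensator N (n N) = \<dots>" .
    then show ?case
      using elim by (simp add: field_simps power2_eq_square)
  qed
  ultimately show ?thesis
    unfolding n_def using Lim_transform_eventually by force
qed

section \<open>From the second moment to convergence in probability\<close>

lemma prob_mart_growing_graph_le:
  fixes t \<delta> :: real
  assumes "0 \<le> t" "t < 1" "0 < \<delta>" "0 < N"
  defines "n \<equiv> nat \<lfloor>t * real N\<rfloor>"
  shows "measure_pmf.prob (growing_graph N) {h. \<delta> * real N \<le> \<bar>mart N n (X n h)\<bar>} \<le>
    1 / ((1 - t) ^ 3 * \<delta>\<^sup>2) * (1 / real N)"
proof -
  have n: "real n \<le> t * real N"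
    unfolding n_def by (rule nat_floor_le[OF assms(1)])
  have "n \<le> N"
    unfolding n_def using assms by (intro nat_floor_mult_le) auto
  \<comment> \<open>At the empty history the martingale is 0 and \<open>N + (N choose 2)\<close>
    steps remain.\<close>
  have "measure_pmf.prob (growing_graph N) {h. \<delta> * real N \<le> \<bar>mart N n (X n h)\<bar>} \<le>
      (real N)\<^sup>2 / (real N - real n + 1) ^ 3 * (real N + real (N choose 2)) / (\<delta> * real N)\<^sup>2"
    using prob_mart_ge[OF history_Nil \<open>n \<le> N\<close>, of "\<delta> * real N"] \<open>0 < \<delta>\<close> \<open>0 < N\<close>
    by (simp add: growing_graph_def mart_0_0)
  also have "\<dots> \<le> (real N)\<^sup>2 / ((1 - t) * real N) ^ 3 * (real N)\<^sup>2 / (\<delta> * real N)\<^sup>2"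
  proof (intro divide_right_mono mult_mono divide_left_mono power_mono)
    show "(1 - t) * real N \<le> real N - real n + 1"
      using n by (simp add: algebra_simps)
    show "real N + real (N choose 2) \<le> (real N)\<^sup>2"
      using two_choose_two[of N] \<open>0 < N\<close> mult_right_mono[of 1 "real N" "real N"]
      by (simp add: power2_eq_square algebra_simps)
  qed (use assms \<open>n \<le> N\<close> in auto)
  also have "\<dots> = 1 / ((1 - t) ^ 3 * \<delta>\<^sup>2) * (1 / real N)"
  proof -
    have "x\<^sup>2 / (q * x) ^ 3 * x\<^sup>2 / (d * x)\<^sup>2 = 1 / (q ^ 3 * d\<^sup>2) * (1 / x)"
      if "0 < x" "0 < q" "0 < d" for x q d :: real
      using that by (simp add: power_mult_distrib power2_eq_square[of x] power3_eq_cube[of x])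
    then show ?thesis
      using assms by simp
  qed
  finally show ?thesis .
qed

lemma prob_pointwise:
  fixes t \<eta> :: real
  assumes "0 \<le> t" "t < 1" "0 < \<eta>"
  shows "(\<lambda>N. measure_pmf.prob (growing_graph N)
    {h. \<eta> < \<bar>2 / (real N)\<^sup>2 * real (X (nat \<lfloor>t * real N\<rfloor>) h) - \<phi> t\<bar>}) \<longlonglongrightarrow> 0"
proof (rule Lim_null_comparison)
  \<comment> \<open>Half of \<open>\<eta>\<close> absorbs the error of the compensator. The other
    half is at most \<open>2 / N ^ 2 * r * \<bar>m\<bar>\<close> with \<open>r \<le> 2 * N\<close>,
    that is \<open>4 * \<bar>m\<bar> / N\<close>, whence the divisor 8.\<close>
  define \<delta> where "\<delta> = \<eta> / 8"
  have \<delta>: "0 < \<delta>"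
    using assms by (simp add: \<delta>_def)
  show "(\<lambda>N. 1 / ((1 - t) ^ 3 * \<delta>\<^sup>2) * (1 / real N)) \<longlonglongrightarrow> 0"
    by (intro tendsto_mult_right_zero lim_1_over_n)
  have "\<forall>\<^sub>F N in sequentially.
      \<bar>2 / (real N)\<^sup>2 * compensator N (nat \<lfloor>t * real N\<rfloor>) - \<phi> t\<bar> < \<eta> / 2"
    using tendstoD[OF tendsto_compensator[OF assms(1,2)], of "\<eta> / 2"] assms
    by (simp add: dist_real_def)
  then show "\<forall>\<^sub>F N in sequentially. norm (measure_pmf.prob (growing_graph N)
      {h. \<eta> < \<bar>2 / (real N)\<^sup>2 * real (X (nat \<lfloor>t * real N\<rfloor>) h) - \<phi> t\<bar>})
      \<le> 1 / ((1 - t) ^ 3 * \<delta>\<^sup>2) * (1 / real N)"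
    using eventually_gt_at_top[of 0]
  proof eventually_elim
    case (elim N)
    define n where "n = nat \<lfloor>t * real N\<rfloor>"
    have "n \<le> N"
      unfolding n_def using assms by (intro nat_floor_mult_le) auto
    have "\<delta> * real N \<le> \<bar>mart N n (X n h)\<bar>"
      if h: "\<eta> < \<bar>2 / (real N)\<^sup>2 * real (X n h) - \<phi> t\<bar>" for h
    proof -
      define m where "m = mart N n (X n h)"
      define r where "r = real N - real n + 1"
      have r: "0 \<le> r" "r \<le> 2 * real N"
        using \<open>n \<le> N\<close> elim by (auto simp: r_def)
      have "2 / (real N)\<^sup>2 * real (X n h) =
          2 / (real N)\<^sup>2 * compensator N n - 2 / (real N)\<^sup>2 * (r * m)"
        unfolding edges_eq_compensator[OF \<open>n \<le> N\<close>, of "X n h"] r_def m_def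
        by (rule right_diff_distrib)
      moreover have "\<eta> / 2 \<le> \<bar>z\<bar>" if "x = c - z" "\<eta> < \<bar>x - p\<bar>" "\<bar>c - p\<bar> < \<eta> / 2" for x c z p :: real
        using that by linarith
      ultimately have "\<eta> / 2 \<le> \<bar>2 / (real N)\<^sup>2 * (r * m)\<bar>"
        using h elim(1) unfolding n_def by blast
      also have "\<dots> = 2 / (real N)\<^sup>2 * (r * \<bar>m\<bar>)"
        using r by (simp add: abs_mult)
      also have "\<dots> \<le> 2 / (real N)\<^sup>2 * ((2 * real N) * \<bar>m\<bar>)"
        using r by (intro mult_left_mono mult_right_mono) auto
      also have "\<dots> = 4 * \<bar>m\<bar> / real N"
        using elim by (simp add: power2_eq_square)
      finally show ?thesis
        using elim by (simp add: m_def \<delta>_def field_simps)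
    qed
    then have "measure_pmf.prob (growing_graph N)
        {h. \<eta> < \<bar>2 / (real N)\<^sup>2 * real (X n h) - \<phi> t\<bar>} \<le>
        measure_pmf.prob (growing_graph N) {h. \<delta> * real N \<le> \<bar>mart N n (X n h)\<bar>}"
      by (intro measure_pmf.finite_measure_mono) auto
    also have "\<dots> \<le> 1 / ((1 - t) ^ 3 * \<delta>\<^sup>2) * (1 / real N)"
      unfolding n_def using elim by (intro prob_mart_growing_graph_le assms \<delta>) auto
    finally show ?case
      by (simp add: n_def)
  qed
qed

section \<open>Uniform convergence\<close>

text \<open>Only the endpoint 1 is delicate: there \<open>(1 - t) * ln (1 - t)\<close> tends to 0
  from the left.\<close>

lemma continuous_on_phi: "continuous_on {0..1} \<phi>"
  unfolding continuous_on_eq_continuous_within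
proof
  fix t :: real
  assume t: "t \<in> {0..1}"
  show "continuous (at t within {0..1}) \<phi>"
  proof (cases "t = 1")
    case True
    have "((\<lambda>t. 2 * (1 - t) * ln (1 - t) + 2 * t - t\<^sup>2) \<longlongrightarrow> 1) (at_left (1 :: real))"
      by real_asymp
    then show ?thesis
      using True unfolding continuous_within phi_eq[abs_def]
      by (simp add: at_within_Icc_at_left)
  next
    case False
    with t have "isCont (\<lambda>t. 2 * (1 - t) * ln (1 - t) + 2 * t - t\<^sup>2) t"
      by (intro continuous_intros) auto
    then show ?thesis
      unfolding phi_eq[abs_def] by (rule continuous_at_imp_continuous_at_within)
  qed
qed

lemma unit_interval_grid:
  fixes t :: real
  assumes "0 \<le> t" "t \<le> 1" "0 < K"
  obtains i where "i < K" "real i / real K \<le> t" "t \<le> real (Suc i) / real K"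
\<comment> \<open>The floor would give \<open>i = K\<close> at \<open>t = 1\<close>, so this point
  is assigned to the last cell.\<close>
proof (cases "t = 1")
  case True
  with assms that[of "K - 1"] show ?thesis
    by (simp add: of_nat_diff)
next
  case False
  define i where "i = nat \<lfloor>t * real K\<rfloor>"
  have i: "real i \<le> t * real K" "t * real K < real i + 1"
    using assms by (auto simp: i_def)
  moreover have "t * real K < real K"
    using assms False by simp
  ultimately have "i < K"
    by linarith
  with i assms that[of i] show ?thesis
    by (simp add: field_simps)
qed

text \<open>Monotonicity squeezes \<open>F t\<close> between its values at the two neighbouring grid
  points, and \<open>f\<close> varies little in between. The point 1 occurs only as a right
  neighbour, so an upper bound for \<open>F 1\<close> suffices.\<close>

lemma abs_diff_le_of_grid:
  fixes F f :: "real \<Rightarrow> real"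
  assumes mono: "\<And>s t. \<lbrakk>0 \<le> s; s \<le> t; t \<le> 1\<rbrakk> \<Longrightarrow> F s \<le> F t"
    and "0 < K"
    and osc: "\<And>s t. \<lbrakk>s \<in> {0..1}; t \<in> {0..1}; \<bar>s - t\<bar> \<le> 1 / real K\<rbrakk> \<Longrightarrow> \<bar>f s - f t\<bar> \<le> e"
    and grid: "\<And>i. i < K \<Longrightarrow> \<bar>F (real i / real K) - f (real i / real K)\<bar> \<le> e"
    and one: "F 1 \<le> f 1 + e"
    and t: "0 \<le> t" "t \<le> 1"
  shows "\<bar>F t - f t\<bar> \<le> 2 * e"
proof -
  obtain i where i: "i < K" "real i / real K \<le> t" "t \<le> real (Suc i) / real K"
    using unit_interval_grid[OF t \<open>0 < K\<close>] .
  define a b where "a = real i / real K" and "b = real (Suc i) / real K"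
  have ab: "0 \<le> a" "a \<le> t" "t \<le> b" "b \<le> 1" and diff: "b - a = 1 / real K"
    using i by (simp_all add: a_def b_def field_simps)
  have "F b \<le> f b + e"
  proof (cases "Suc i = K")
    case True
    then show ?thesis
      using one \<open>0 < K\<close> by (simp add: b_def)
  next
    case False
    then show ?thesis
      using grid[of "Suc i"] i(1) unfolding b_def by linarith
  qed
  moreover have "f a - e \<le> F a"
    using grid[OF i(1)] unfolding a_def by linarith
  moreover have "F a \<le> F t" "F t \<le> F b"
    using mono ab by auto
  moreover have "\<bar>f a - f t\<bar> \<le> e" "\<bar>f b - f t\<bar> \<le> e"
    using ab diff by (auto intro!: osc)
  ultimately show ?thesis
    by linarith
qed

section \<open>The rescaled process on complete histories\<close>

lemma scaled_X_mono:
  assumes "h \<in> set_pmf (growing_graph N)" "0 \<le> s" "s \<le> t" "t \<le> 1"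
  shows "2 / (real N)\<^sup>2 * real (X (nat \<lfloor>s * real N\<rfloor>) h) \<le>
    2 / (real N)\<^sup>2 * real (X (nat \<lfloor>t * real N\<rfloor>) h)"
proof -
  have "nat \<lfloor>s * real N\<rfloor> \<le> nat \<lfloor>t * real N\<rfloor>"
    using assms by (intro nat_mono floor_mono mult_right_mono) auto
  moreover have "nat \<lfloor>t * real N\<rfloor> \<le> N"
    using assms by (intro nat_floor_mult_le) auto
  ultimately have "X (nat \<lfloor>s * real N\<rfloor>) h \<le> X (nat \<lfloor>t * real N\<rfloor>) h"
    using growing_graph_complete(1)[OF assms(1)] by (intro X_mono) auto
  then show ?thesis
    by (intro mult_left_mono) auto
qed

lemma scaled_X_le_one:
  assumes "h \<in> set_pmf (growing_graph N)"
  shows "2 / (real N)\<^sup>2 * real (X n h) \<le> 1"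
proof -
  have "X n h \<le> N choose 2"
    using X_le_num_edges num_edges_le growing_graph_complete[OF assms] le_trans by metis
  then have "2 * real (X n h) \<le> 2 * real (N choose 2)"
    by simp
  also have "\<dots> \<le> (real N)\<^sup>2"
    unfolding two_choose_two by (simp add: power2_eq_square algebra_simps)
  \<comment> \<open>For \<open>N = 0\<close> the factor \<open>2 / N ^ 2\<close> is 0 by the
    convention on division.\<close>
  finally show ?thesis
    by (cases "N = 0") (simp_all add: divide_le_eq_1)
qed

theorem theorem3:
  shows "\<forall>\<epsilon>::real. \<epsilon> > 0 \<longrightarrow>
    (\<lambda>N::nat. measure_pmf.prob (growing_graph N)
       {h. (SUP t\<in>{0..1::real}.
              \<bar>2 / (real N)\<^sup>2 * real (X (nat \<lfloor>t * real N\<rfloor>) h) - \<phi> t\<bar>) > \<epsilon>})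
      \<longlonglongrightarrow> 0"
proof (intro allI impI)
  fix \<epsilon> :: real
  assume "\<epsilon> > 0"
  define F where "F N h t = 2 / (real N)\<^sup>2 * real (X (nat \<lfloor>t * real N\<rfloor>) h)" for N h t
  have "uniformly_continuous_on {0..1} \<phi>"
    by (intro compact_uniformly_continuous continuous_on_phi) simp
  then obtain d where "d > 0"
    and d: "\<And>s t. \<lbrakk>s \<in> {0..1}; t \<in> {0..1}; \<bar>s - t\<bar> < d\<rbrakk> \<Longrightarrow> \<bar>\<phi> s - \<phi> t\<bar> < \<epsilon> / 2"
    using \<open>\<epsilon> > 0\<close> unfolding uniformly_continuous_on_def dist_real_def by (meson half_gt_zero)
  \<comment> \<open>The mesh \<open>1 / K\<close> is fixed before \<open>N\<close> grows, so
    finitely many pointwise limits suffice.\<close>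
  obtain K where "0 < K" and K: "1 / real K < d"
    using \<open>d > 0\<close> by (metis real_arch_inverse inverse_eq_divide gr0I)
  define bad where "bad N i = {h. \<epsilon> / 2 < \<bar>F N h (real i / real K) - \<phi> (real i / real K)\<bar>}" for N i
  have "(\<lambda>N. \<Sum>i<K. measure_pmf.prob (growing_graph N) (bad N i)) \<longlonglongrightarrow> (\<Sum>i<K. 0)"
    unfolding bad_def F_def
    by (intro tendsto_sum prob_pointwise) (use \<open>\<epsilon> > 0\<close> in auto)
  then have lim: "(\<lambda>N. \<Sum>i<K. measure_pmf.prob (growing_graph N) (bad N i)) \<longlonglongrightarrow> 0"
    by simp
  have "measure_pmf.prob (growing_graph N) {h. (SUP t\<in>{0..1}. \<bar>F N h t - \<phi> t\<bar>) > \<epsilon>} \<le>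
      (\<Sum>i<K. measure_pmf.prob (growing_graph N) (bad N i))" for N
  proof -
    \<comment> \<open>A deterministic inclusion on the support: outside the bad events at the grid
      points the supremum is at most \<open>2 * (\<epsilon> / 2)\<close>.\<close>
    have "h \<in> (\<Union>i<K. bad N i)"
      if h: "h \<in> set_pmf (growing_graph N)" and sup: "(SUP t\<in>{0..1}. \<bar>F N h t - \<phi> t\<bar>) > \<epsilon>" for h
    proof (rule ccontr)
      assume "h \<notin> (\<Union>i<K. bad N i)"
      then have grid: "\<bar>F N h (real i / real K) - \<phi> (real i / real K)\<bar> \<le> \<epsilon> / 2" if "i < K" for i
        using that by (auto simp: bad_def not_less)
      have "\<bar>F N h t - \<phi> t\<bar> \<le> 2 * (\<epsilon> / 2)" if "t \<in> {0..1}" for t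
      proof (rule abs_diff_le_of_grid[where K = K and f = \<phi>, OF _ \<open>0 < K\<close> _ grid])
        show "F N h s \<le> F N h t" if "0 \<le> s" "s \<le> t" "t \<le> 1" for s t
          unfolding F_def by (rule scaled_X_mono[OF h that])
        show "\<bar>\<phi> s - \<phi> t\<bar> \<le> \<epsilon> / 2" if "s \<in> {0..1}" "t \<in> {0..1}" "\<bar>s - t\<bar> \<le> 1 / real K" for s t
          using d[of s t] that K by linarith
        \<comment> \<open>At time 1 the trivial bound by the complete graph is already sharp,
          because \<open>\<phi> 1 = 1\<close>.\<close>
        show "F N h 1 \<le> \<phi> 1 + \<epsilon> / 2"
          using scaled_X_le_one[OF h] \<open>\<epsilon> > 0\<close> unfolding F_def
          by (simp add: \<phi>_def add_increasing2)
      qed (use that in auto)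
      then have "(SUP t\<in>{0..1}. \<bar>F N h t - \<phi> t\<bar>) \<le> \<epsilon>"
        by (intro cSUP_least) auto
      with sup show False
        by simp
    qed
    then have "measure_pmf.prob (growing_graph N) {h. (SUP t\<in>{0..1}. \<bar>F N h t - \<phi> t\<bar>) > \<epsilon>} \<le>
        measure_pmf.prob (growing_graph N) (\<Union>i<K. bad N i)"
      by (intro measure_pmf.finite_measure_mono_AE) (auto simp: AE_measure_pmf_iff)
    also have "\<dots> \<le> (\<Sum>i<K. measure_pmf.prob (growing_graph N) (bad N i))"
      by (intro measure_pmf.finite_measure_subadditive_finite) auto
    finally show ?thesis .
  qed
  then show "(\<lambda>N. measure_pmf.prob (growing_graph N)
       {h. (SUP t\<in>{0..1}. \<bar>2 / (real N)\<^sup>2 * real (X (nat \<lfloor>t * real N\<rfloor>) h) - \<phi> t\<bar>) > \<epsilon>})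
      \<longlonglongrightarrow> 0"
    unfolding F_def by (intro Lim_null_comparison[OF _ lim]) auto
qed

end
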